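(* Let $p>1$ be an integer and let $\mathbb{Z}_p^{*}$ be the Abelian group of positive integers less than $p$ and relatively prime to $p$, with multiplication modulo $p$. Consider the automorphism $\theta_p\colon \mathbb{Z}_p^{*}\to\mathbb{Z}_p^{*}$ defined by $\theta_p(q)=q^{-1}$ (the inverse of $q$ in the group $\mathbb{Z}_p^{*}$). Then for any $q\in\mathbb{Z}_p^{*}$ we have $$\theta_p(q)\equiv q^{\phi(p)-1} \pmod p,$$ where $\phi$ is Euler's totient function. Moreover, for any $q\in\mathbb{Z}_p^{*}$ with $q>1$, $$B_1(p,q)=\left(\theta_p(q),\ \frac{q\,\theta_p(q)-1}{p}\right),$$ where $\theta_p(q)$ is regarded as a positive integer less than $p$ and the product $q\,\theta_p(q)$ is taken in $\mathbb{Z}$.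
   Context: Elements of $\mathbb{Z}_p^{*}$ are actual integers in $\{1,\dots,p-1\}$ relatively prime to $p$. For relatively prime integers $p>1$ and $q>1$, the $1$-Bézout coefficients of $(p,q)$ are the unique pair of relatively prime integers $B_1(p,q)=(a,b)$ such that $0<a\le p$, $0<b\le q$ and $aq-bp=1$. *)

theory Defs
  imports "HOL-Number_Theory.Number_Theory"
begin

definition Zstar :: "int \<Rightarrow> int monoid"
  where "Zstar p = units_of (residue_ring p)"

lemma carrier_Zstar:
  assumes "p > 1"
  shows "carrier (Zstar p) = {q. 0 < q \<and> q < p \<and> coprime q p}"
proof -
  interpret residues p "residue_ring p"
    using assms by unfold_locales simp_all
  show ?thesis
    by (simp add: Zstar_def units_of_carrier res_units_eq)
qed

lemma mult_Zstar: "x \<otimes>\<^bsub>Zstar p\<^esub> y = x * y mod p"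
  by (simp add: Zstar_def units_of_mult residue_ring_def)

lemma comm_group_Zstar:
  assumes "p > 1"
  shows "comm_group (Zstar p)"
proof -
  interpret residues p "residue_ring p"
    using assms by unfold_locales simp_all
  show ?thesis
    by (simp add: Zstar_def units_comm_group)
qed

definition theta :: "int \<Rightarrow> int \<Rightarrow> int"
  where "theta p q = inv\<^bsub>Zstar p\<^esub> q"

definition is_bezout1 :: "int \<Rightarrow> int \<Rightarrow> int \<times> int \<Rightarrow> bool"
  where "is_bezout1 p q = (\<lambda>(a, b).
    coprime a b \<and>
    0 < a \<and> a \<le> p \<and> 0 < b \<and> b \<le> q \<and> a * q - b * p = 1)"

text \<open>The pair is well defined only for coprime \<open>p, q > 1\<close>; see the lemma below.\<close>

definition bezout1 :: "int \<Rightarrow> int \<Rightarrow> int \<times> int"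
  where "bezout1 p q = (THE ab. is_bezout1 p q ab)"

lemma is_bezout1_unique_exists:
  assumes "p > 1" and "q > 1" and "coprime p q"
  shows "\<exists>!ab. is_bezout1 p q ab"
proof -
  obtain u where u: "[q * u = 1] (mod p)"
    using cong_solve_coprime_int[of q p] assms(3) by (auto simp: coprime_commute)
  define a where "a = u mod p"
  have "[q * a = 1] (mod p)"
    using u unfolding a_def by (simp add: cong_def mod_mult_right_eq)
  then obtain b where b: "q * a - 1 = p * b"
    by (auto simp: cong_iff_dvd_diff)
  have "0 \<le> a" "a < p"
    using assms by (auto simp: a_def)
  moreover have "a \<noteq> 0"
  proof
    assume "a = 0"
    then have "p dvd 1"
      using b by (metis diff_0 dvd_minus_iff dvd_triv_left mult_zero_right)
    with assms show False by simp
  qed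
  ultimately have a: "0 < a" "a < p" by auto
  have "q * a > 1 * 1"
    using a assms by (intro mult_less_le_imp_less) auto
  then have "p * b > 0" using b by linarith
  then have b0: "0 < b" using assms by (simp add: zero_less_mult_iff)
  have "p * b < p * q"
  proof -
    have "q * a < q * p"
      using a assms by (intro mult_strict_left_mono) auto
    then have "p * b < q * p" using b by linarith
    then show ?thesis by (simp only: mult.commute)
  qed
  then have bq: "b < q" using assms by (simp add: mult_less_cancel_left_pos)
  have "coprime a b"
  proof (rule coprimeI)
    fix c assume "c dvd a" "c dvd b"
    then have "c dvd q * a - p * b" by simp
    then show "is_unit c" using b by (simp add: algebra_simps)
  qed
  then have ex: "is_bezout1 p q (a, b)"
    using a b b0 bq by (simp add: is_bezout1_def algebra_simps)
  show ?thesis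
  proof (rule ex1I[of _ "(a, b)"])
    show "is_bezout1 p q (a, b)" by (fact ex)
  next
    fix ab assume "is_bezout1 p q ab"
    then obtain c d where ab: "ab = (c, d)" and c: "0 < c" "c \<le> p"
      and cd: "c * q - d * p = 1"
      by (cases ab) (auto simp: is_bezout1_def)
    have "(c - a) * q = p * (d - b)"
      using b cd by (simp add: algebra_simps)
    then have "p dvd (c - a) * q" by simp
    then have dvd: "p dvd c - a"
      using assms(3) by (simp add: coprime_dvd_mult_left_iff)
    have "\<bar>c - a\<bar> < p" using a c by linarith
    then have "c = a"
      using dvd dvd_imp_le_int[of "c - a" p] assms by force
    moreover from this have "d = b"
      using b cd assms by (simp add: algebra_simps)
    ultimately show "ab = (a, b)" using ab by simp
  qed
qed

end

theory Submission
  imports Defs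
begin

text \<open>
  The whole statement rests on one fact: for \<open>q\<close> in \<open>Zstar p\<close>, the integer \<open>theta p q\<close> is the unique
  representative in \<open>{1, \<dots>, p - 1}\<close> of a solution of \<open>q * x = 1\<close> modulo \<open>p\<close>
  (\<open>theta_bounds\<close>, \<open>cong_mult_theta\<close>).

  Inversion is an automorphism of every Abelian group, so in particular of \<open>Zstar p\<close>.
  By Euler's theorem \<open>q ^ (totient p - 1)\<close> also solves \<open>q * x = 1\<close>, and solutions are
  congruent because \<open>q\<close> can be cancelled. Finally, dividing \<open>q * theta p q - 1\<close> by
  \<open>p\<close> yields the integer \<open>b\<close> with \<open>theta p q * q - b * p = 1\<close>; if
  \<open>q > 1\<close>, then \<open>1 < q * theta p q < q * p\<close>, which places \<open>b\<close> in the range required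
  of the second coefficient (\<open>is_bezout1_theta\<close>), and only one pair meets all the
  conditions on the 1-Bezout coefficients.
\<close>

lemma (in comm_group) m_inv_iso: "m_inv G \<in> iso G G"
proof (rule isoI)
  show "m_inv G \<in> hom G G"
    by (rule homI) (simp_all add: inv_mult)
  show "bij_betw (m_inv G) (carrier G) (carrier G)"
    by (rule bij_betw_byWitness[where f' = "m_inv G"]) auto
qed

lemma theta_bounds:
  assumes "p > 1" and "q \<in> carrier (Zstar p)"
  shows "0 < theta p q" and "theta p q < p"
proof -
  interpret comm_group "Zstar p"
    by (rule comm_group_Zstar) (fact assms(1))
  have "theta p q \<in> carrier (Zstar p)"
    using assms(2) by (simp add: theta_def)
  then show "0 < theta p q" and "theta p q < p"
    by (simp_all add: carrier_Zstar[OF assms(1)])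
qed

lemma cong_mult_theta:
  assumes "p > 1" and "q \<in> carrier (Zstar p)"
  shows "[q * theta p q = 1] (mod p)"
proof -
  interpret comm_group "Zstar p"
    by (rule comm_group_Zstar) (fact assms(1))
  have "q * theta p q mod p = \<one>\<^bsub>Zstar p\<^esub>"
    using r_inv[OF assms(2)] by (simp add: mult_Zstar theta_def)
  also have "\<one>\<^bsub>Zstar p\<^esub> = 1"
    by (simp add: Zstar_def units_of_one residue_ring_def)
  finally show ?thesis
    using assms(1) by (simp add: cong_def)
qed

text \<open>
  Both sides become \<open>1\<close> modulo \<open>p\<close> after multiplication by the unit \<open>q\<close>, the right
  one by Euler's theorem.
\<close>

lemma theta_cong_power:
  assumes "p > 1" and "q \<in> carrier (Zstar p)"
  shows "[theta p q = q ^ (totient (nat p) - 1)] (mod p)"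
proof -
  interpret residues p "residue_ring p"
    using assms(1) by unfold_locales simp_all
  have coprime: "coprime q p"
    using assms by (simp add: carrier_Zstar)
  have "totient (nat p) > 0"
    using assms(1) by simp
  then have "q * q ^ (totient (nat p) - 1) = q ^ totient (nat p)"
    by (simp add: power_eq_if)
  then have "[q * q ^ (totient (nat p) - 1) = 1] (mod p)"
    using euler_theorem[OF coprime] by simp
  with cong_mult_theta[OF assms]
  have "[q * theta p q = q * q ^ (totient (nat p) - 1)] (mod p)"
    using cong_sym cong_trans by blast
  then show ?thesis
    using coprime by (simp add: cong_mult_lcancel)
qed

text \<open>
  The equation \<open>theta p q * q - b * p = 1\<close> holds by the choice of \<open>b\<close>, and it makes
  every common divisor of \<open>theta p q\<close> and \<open>b\<close> a unit.
\<close>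

lemma is_bezout1_theta:
  assumes "p > 1" and "q \<in> carrier (Zstar p)" and "q > 1"
  shows "is_bezout1 p q (theta p q, (q * theta p q - 1) div p)"
proof -
  define a where "a = theta p q"
  define b where "b = (q * a - 1) div p"
  have a: "0 < a" "a < p"
    using theta_bounds[OF assms(1,2)] by (simp_all add: a_def)
  have "p dvd q * a - 1"
    using cong_mult_theta[OF assms(1,2)] by (simp add: a_def cong_iff_dvd_diff)
  then have bp: "b * p = q * a - 1"
    by (simp add: b_def)
  \<comment> \<open>This is where \<open>q > 1\<close> enters: for \<open>q = 1\<close> the quotient would be \<open>0\<close>.\<close>
  have "1 * 1 < q * a"
    using a assms(3) by (intro mult_less_le_imp_less) auto
  then have "0 < b * p"
    using bp by linarith
  then have b_pos: "0 < b"
    using assms(1) by (simp add: zero_less_mult_iff)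
  have "q * a < q * p"
    using a assms(3) by simp
  then have "b * p < q * p"
    using bp by linarith
  then have b_less: "b < q"
    using assms(1) by simp
  have "coprime a b"
  proof (rule coprimeI)
    fix c assume "c dvd a" "c dvd b"
    then have "c dvd q * a - b * p" by simp
    then show "is_unit c" using bp by simp
  qed
  then have "is_bezout1 p q (a, b)"
    using a b_pos b_less bp by (simp add: is_bezout1_def mult.commute)
  then show ?thesis
    by (simp add: a_def b_def)
qed

theorem theorem2p4:
  fixes p :: int
  assumes "p > 1"
  shows "theta p \<in> iso (Zstar p) (Zstar p)
  \<and> (\<forall>q \<in> carrier (Zstar p). [theta p q = q ^ (totient (nat p) - 1)] (mod p))
  \<and> (\<forall>q \<in> carrier (Zstar p). q > 1 \<longrightarrow>
           p dvd q * theta p q - 1 \<and>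
           bezout1 p q = (theta p q, (q * theta p q - 1) div p))"
proof (intro conjI ballI impI)
  have "theta p = m_inv (Zstar p)"
    by (rule ext) (rule theta_def)
  then show "theta p \<in> iso (Zstar p) (Zstar p)"
    using comm_group.m_inv_iso[OF comm_group_Zstar[OF assms]] by simp
next
  fix q assume q: "q \<in> carrier (Zstar p)"
  show "[theta p q = q ^ (totient (nat p) - 1)] (mod p)"
    by (rule theta_cong_power[OF assms q])
  show "p dvd q * theta p q - 1"
    using cong_mult_theta[OF assms q] by (simp add: cong_iff_dvd_diff)
  assume "q > 1"
  have "coprime p q"
    using q by (simp add: carrier_Zstar[OF assms] coprime_commute)
  then show "bezout1 p q = (theta p q, (q * theta p q - 1) div p)"
    unfolding bezout1_def
    using is_bezout1_unique_exists[OF assms \<open>q > 1\<close>] is_bezout1_theta[OF assms q \<open>q > 1\<close>]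
    by (intro the1_equality) auto
qed

end
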